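(* Let $\Pi$ be a Gibbs partition with parameters $(\alpha,V)$, let $n\ge1$, and let $C_{l,n}$, $l=1,\dots,n$, be the number of blocks of size $l$ of the restriction of $\Pi$ to $[n]$. For all nonnegative integers $r_1,\dots,r_n$ with $\sum_{l=1}^n l r_l\le n$, $$\mathbb{E}\Big[\prod_{l=1}^n (C_{l,n})_{[r_l]}\Big]=\frac{n!}{\prod_{l=1}^n(l!)^{r_l}}\,\frac{\prod_{l=1}^n[(1-\alpha)_{l-1}]^{r_l}}{(n-\sum_l l r_l)!}\sum_{k-\sum_l r_l=0}^{n-\sum_l l r_l}V_{n,k}\,S^{-1,-\alpha}_{n-\sum_l l r_l,\;k-\sum_l r_l}.$$ In particular, for every $l\in\{1,\dots,n\}$ and every nonnegative integer $r\le\lfloor n/l\rfloor$, $$\mathbb{E}\big[(C_{l,n})_{[r]}\big]=\frac{n!\,[(1-\alpha)_{l-1}]^r}{(l!)^r(n-lr)!}\sum_{k-r=0}^{n-rl}V_{n,k}\,S^{-1,-\alpha}_{n-rl,\,k-r}.$$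
   Context: Notation: $(x)_n=x(x+1)\cdots(x+n-1)$ ($(x)_0=1$); $(x)_{[n]}=x(x-1)\cdots(x-n+1)$ ($(x)_{[0]}=1$); $\sum_{k-a=0}^{M}$ means $k$ ranges over $a,\dots,a+M$. Gibbs partition with parameters $(\alpha,V)$: $\alpha\in(-\infty,1)$ and $V=(V_{n,k})_{1\le k\le n}$ are nonnegative weights with $V_{1,1}=1$ and $V_{n,k}=(n-k\alpha)V_{n+1,k}+V_{n+1,k+1}$; $\Pi$ is the exchangeable random partition of the positive integers such that for every $n$ and every partition $\{A_1,\dots,A_k\}$ of $[n]=\{1,\dots,n\}$, the restriction $\Pi_n$ of $\Pi$ to $[n]$ satisfies $\mathbb{P}(\Pi_n=\{A_1,\dots,A_k\})=V_{n,k}\prod_{i=1}^k(1-\alpha)_{|A_i|-1}$. (Terms multiplied by $S^{-1,-\alpha}_{n,0}=0$ with $V_{n,0}$ are read as $0$.) Generalized central Stirling numbers: $S^{-1,-\alpha}_{n,k}=\frac{n!}{k!}\sum_{(n_1,\dots,n_k)}\prod_{j=1}^k\frac{(1-\alpha)_{n_j-1}}{n_j!}$, the sum being over compositions of $n$ into $k$ positive parts ($S_{0,0}^{-1,-\alpha}=1$, $S_{n,0}^{-1,-\alpha}=0$ for $n\ge1$, $S_{n,k}^{-1,-\alpha}=0$ for $k>n$). *)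

theory Defs
  imports
    "HOL-Probability.Probability"
    "HOL-Combinatorics.Permutations"
begin

text \<open>Falling factorial \<open>x (x - 1) \<dots> (x - n + 1)\<close>; the rising one is \<^const>\<open>pochhammer\<close>.\<close>

definition falling_factorial :: "'a::comm_ring_1 \<Rightarrow> nat \<Rightarrow> 'a" where
  "falling_factorial x n = (\<Prod>i<n. x - of_nat i)"

definition compositions :: "nat \<Rightarrow> nat \<Rightarrow> nat list set" where
  "compositions n k = {ns. length ns = k \<and> (\<forall>m\<in>set ns. 0 < m) \<and> sum_list ns = n}"

lemma finite_compositions: "finite (compositions n k)"
proof (rule finite_subset)
  show "compositions n k \<subseteq> {ns. set ns \<subseteq> {..n} \<and> length ns = k}"
    by (auto simp: compositions_def dest: member_le_sum_list)
  show "finite {ns. set ns \<subseteq> {..n} \<and> length ns = k}"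
    by (rule finite_lists_length_eq) simp
qed

text \<open>The generalized central Stirling numbers with superscripts \<open>-1, -\<alpha>\<close>.\<close>

definition gen_stirling :: "real \<Rightarrow> nat \<Rightarrow> nat \<Rightarrow> real" where
  "gen_stirling \<alpha> n k = fact n / fact k *
     (\<Sum>ns\<in>compositions n k. \<Prod>j<k. pochhammer (1 - \<alpha>) (ns ! j - 1) / fact (ns ! j))"

lemma gen_stirling_0_0: "gen_stirling \<alpha> 0 0 = 1"
proof -
  have "compositions 0 0 = {[]}"
    by (auto simp: compositions_def)
  then show ?thesis
    by (simp add: gen_stirling_def)
qed

lemma gen_stirling_n_0: "n \<ge> 1 \<Longrightarrow> gen_stirling \<alpha> n 0 = 0"
proof -
  assume "n \<ge> 1"
  then have "compositions n 0 = {}"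
    by (auto simp: compositions_def)
  then show ?thesis
    by (simp add: gen_stirling_def)
qed

lemma length_le_sum_list_pos: "\<forall>m\<in>set ns. 0 < m \<Longrightarrow> length ns \<le> sum_list (ns :: nat list)"
  by (induction ns) auto

lemma gen_stirling_eq_0: "k > n \<Longrightarrow> gen_stirling \<alpha> n k = 0"
proof -
  assume "k > n"
  then have "compositions n k = {}"
    using length_le_sum_list_pos by (fastforce simp: compositions_def)
  then show ?thesis
    by (simp add: gen_stirling_def)
qed

text \<open>Only the values \<open>V n k\<close> with \<open>1 \<le> k \<le> n\<close> are constrained.\<close>

definition gibbs_weights :: "real \<Rightarrow> (nat \<Rightarrow> nat \<Rightarrow> real) \<Rightarrow> bool" where
  "gibbs_weights \<alpha> V \<longleftrightarrow>
     (\<forall>n k. 1 \<le> k \<and> k \<le> n \<longrightarrow> 0 \<le> V n k) \<and>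
     V 1 1 = 1 \<and>
     (\<forall>n k. 1 \<le> k \<and> k \<le> n \<longrightarrow>
        V n k = (real n - real k * \<alpha>) * V (n + 1) k + V (n + 1) (k + 1))"

definition restrict_partition :: "nat \<Rightarrow> nat set set \<Rightarrow> nat set set" where
  "restrict_partition n P = (\<lambda>A. A \<inter> {1..n}) ` P - {{}}"

text \<open>A random partition of the positive integers: the sigma-algebra on partitions is the one
  generated by the restrictions to all \<open>{1..n}\<close>, each ranging over a finite discrete space.\<close>

locale random_partition = prob_space M
  for M :: "'w measure" and X :: "'w \<Rightarrow> nat set set" +
  assumes partition_on_X: "\<omega> \<in> space M \<Longrightarrow> partition_on {1..} (X \<omega>)"
    and measurable_restrict:
      "(\<lambda>\<omega>. restrict_partition n (X \<omega>)) \<in> M \<rightarrow>\<^sub>M count_space {P. partition_on {1..n} P}"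

locale exchangeable_random_partition = random_partition +
  assumes exchangeable:
    "\<sigma> permutes {1..n} \<Longrightarrow> partition_on {1..n} P \<Longrightarrow>
       prob {\<omega> \<in> space M. restrict_partition n (X \<omega>) = (`) \<sigma> ` P} =
       prob {\<omega> \<in> space M. restrict_partition n (X \<omega>) = P}"

locale gibbs_partition = exchangeable_random_partition M X
  for M :: "'w measure" and X :: "'w \<Rightarrow> nat set set" and \<alpha> :: real and V :: "nat \<Rightarrow> nat \<Rightarrow> real" +
  assumes alpha_less_1: "\<alpha> < 1"
    and weights: "gibbs_weights \<alpha> V"
    and prob_restrict:
      "n \<ge> 1 \<Longrightarrow> partition_on {1..n} P \<Longrightarrow>
         prob {\<omega> \<in> space M. restrict_partition n (X \<omega>) = P} =
         V n (card P) * (\<Prod>A\<in>P. pochhammer (1 - \<alpha>) (card A - 1))"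

definition block_count :: "('w \<Rightarrow> nat set set) \<Rightarrow> nat \<Rightarrow> nat \<Rightarrow> 'w \<Rightarrow> nat" where
  "block_count X l n \<omega> = card {A \<in> restrict_partition n (X \<omega>). card A = l}"

end

theory Submission
  imports Defs
begin

text \<open>Double counting: summing over the partitions of \<open>A\<close> with a marked block \<open>B\<close> is the same as
  summing over the nonempty \<open>B \<subseteq> A\<close> and the partitions of \<open>A - B\<close>. Marking a block of size \<open>l\<close>
  accounts for the leading factor of \<open>(C\<^sub>l)\<^bsub>[r]\<^esub> = C\<^sub>l (C\<^sub>l - 1)\<^bsub>[r-1]\<^esub>\<close>, since \<open>C\<^sub>l - 1\<close> is the count
  after removal of the marked block; this gives an induction on \<open>\<Sum>\<^sub>l r\<^sub>l\<close>, in which \<open>V\<close> is shifted by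
  one block at each step. Once all \<open>r\<^sub>l\<close> vanish, what remains is the total weight of the partitions
  with \<open>k\<close> blocks; marking an arbitrary block shows that it satisfies the recurrence of the
  generalized Stirling numbers.\<close>

section \<open>Partitions with a marked block\<close>

lemma partition_on_remove_block:
  assumes "partition_on A P" "B \<in> P"
  shows "partition_on (A - B) (P - {B})"
proof -
  have "disjnt B (\<Union> (P - {B}))"
    using partition_onD2[OF assms(1)] assms(2) by (auto simp: pairwise_def disjnt_iff)
  from partition_on_insert[OF this, of A] show ?thesis
    using assms by (simp add: insert_absorb)
qed

lemma partition_on_insert_block:
  assumes "partition_on (A - B) Q" "B \<subseteq> A" "B \<noteq> {}"
  shows "partition_on A (insert B Q)" "B \<notin> Q"
proof -
  have "\<Union> Q = A - B"
    using partition_onD1[OF assms(1)] by simp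
  then show "B \<notin> Q" "partition_on A (insert B Q)"
    using assms partition_on_insert[of B Q A] by (auto simp: disjnt_def)
qed

text \<open>\<open>(P, B)\<close> and \<open>(B, P - {B})\<close> determine each other: a nonempty
  \<open>B\<close> is disjoint from every block of a partition of \<open>A - B\<close>, so it can be
  put back. The summand depends on \<open>B\<close> and \<open>P - {B}\<close> only, which lets
  inductions pass to \<open>A - B\<close>.\<close>

lemma sum_partitions_marked_block:
  fixes F :: "'a set \<Rightarrow> 'a set set \<Rightarrow> 'b::comm_monoid_add"
  assumes "finite A"
  shows "(\<Sum>P | partition_on A P. \<Sum>B\<in>P. F B (P - {B})) =
         (\<Sum>B\<in>Pow A - {{}}. \<Sum>Q | partition_on (A - B) Q. F B Q)"
proof -
  have fin: "finite P" if "partition_on A P" for P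
    using finite_elements[OF assms that] .
  have fin': "finite {Q. partition_on (A - B) Q}" for B
    using finitely_many_partition_on[of "A - B"] assms by simp
  have "(\<Sum>P | partition_on A P. \<Sum>B\<in>P. F B (P - {B})) =
        (\<Sum>(P, B)\<in>(SIGMA P:{P. partition_on A P}. P). F B (P - {B}))"
    using finitely_many_partition_on[OF assms] fin by (intro sum.Sigma) auto
  also have "\<dots> = (\<Sum>(B, Q)\<in>(SIGMA B:Pow A - {{}}. {Q. partition_on (A - B) Q}). F B Q)"
  proof (rule sum.reindex_bij_witness[where i = "\<lambda>(B, Q). (insert B Q, B)"
        and j = "\<lambda>(P, B). (B, P - {B})"])
    fix x assume x: "x \<in> (SIGMA P:{P. partition_on A P}. P)"
    then obtain P B where [simp]: "x = (P, B)" and P: "partition_on A P" "B \<in> P"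
      by auto
    show "(case case x of (P, B) \<Rightarrow> (B, P - {B}) of (B, Q) \<Rightarrow> (insert B Q, B)) = x"
      using P by auto
    have "B \<subseteq> A" "B \<noteq> {}"
      using P unfolding partition_on_def by auto
    then show "(case x of (P, B) \<Rightarrow> (B, P - {B})) \<in>
        (SIGMA B:Pow A - {{}}. {Q. partition_on (A - B) Q})"
      using partition_on_remove_block[OF P] by auto
  next
    fix y assume y: "y \<in> (SIGMA B:Pow A - {{}}. {Q. partition_on (A - B) Q})"
    then obtain B Q where [simp]: "y = (B, Q)"
      and Q: "partition_on (A - B) Q" "B \<subseteq> A" "B \<noteq> {}"
      by auto
    show "(case case y of (B, Q) \<Rightarrow> (insert B Q, B) of (P, B) \<Rightarrow> (B, P - {B})) = y"
      using partition_on_insert_block[OF Q] by auto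
    show "(case y of (B, Q) \<Rightarrow> (insert B Q, B)) \<in> (SIGMA P:{P. partition_on A P}. P)"
      using partition_on_insert_block[OF Q] by auto
  qed auto
  also have "\<dots> = (\<Sum>B\<in>Pow A - {{}}. \<Sum>Q | partition_on (A - B) Q. F B Q)"
    using assms fin' by (intro sum.Sigma[symmetric]) auto
  finally show ?thesis .
qed

text \<open>Turns a sum over the possible marked blocks into a binomial sum over their sizes, the
  shape of \<open>gen_stirling_Suc\<close>.\<close>

lemma sum_nonempty_subsets_by_card:
  fixes f :: "nat \<Rightarrow> real"
  assumes "finite A"
  shows "(\<Sum>B\<in>Pow A - {{}}. f (card B)) = (\<Sum>m=1..card A. real (card A choose m) * f m)"
proof -
  have "(\<Sum>B\<in>Pow A - {{}}. f (card B)) =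
        (\<Sum>m=1..card A. \<Sum>B\<in>{B \<in> Pow A - {{}}. card B = m}. f (card B))"
    using assms by (intro sum.group[symmetric])
      (auto simp: card_gt_0_iff Suc_le_eq finite_subset intro: card_mono)
  also have "\<dots> = (\<Sum>m=1..card A. real (card A choose m) * f m)"
  proof (intro sum.cong refl)
    fix m assume "m \<in> {1..card A}"
    then have "{B \<in> Pow A - {{}}. card B = m} = {B. B \<subseteq> A \<and> card B = m}"
      by auto
    then show "(\<Sum>B\<in>{B \<in> Pow A - {{}}. card B = m}. f (card B)) = real (card A choose m) * f m"
      using n_subsets[OF assms, of m] by simp
  qed
  finally show ?thesis .
qed

section \<open>Block generating function of set partitions\<close>

text \<open>Splits off the first part \<open>m\<close> of a composition; the tail is a composition
  of \<open>n - m\<close>.\<close>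

lemma sum_compositions_Suc:
  fixes f :: "nat \<Rightarrow> 'b::comm_semiring_1"
  shows "(\<Sum>ns\<in>compositions n (Suc k). \<Prod>j<Suc k. f (ns ! j)) =
         (\<Sum>m=1..n. f m * (\<Sum>ns\<in>compositions (n - m) k. \<Prod>j<k. f (ns ! j)))"
proof -
  have "(\<Sum>m=1..n. f m * (\<Sum>ns\<in>compositions (n - m) k. \<Prod>j<k. f (ns ! j))) =
        (\<Sum>(m, ns)\<in>(SIGMA m:{1..n}. compositions (n - m) k). f m * (\<Prod>j<k. f (ns ! j)))"
    by (simp add: sum_distrib_left sum.Sigma finite_compositions)
  also have "\<dots> = (\<Sum>ns\<in>compositions n (Suc k). \<Prod>j<Suc k. f (ns ! j))"
    by (rule sum.reindex_bij_witness[where i = "\<lambda>ns. (hd ns, tl ns)" and j = "\<lambda>(m, ns). m # ns"])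
      (auto simp: compositions_def length_Suc_conv prod.lessThan_Suc_shift Suc_le_eq
        simp del: prod.lessThan_Suc)
  finally show ?thesis by simp
qed

text \<open>The factor \<open>Suc k\<close> reduces \<open>1 / fact (Suc k)\<close> to
  \<open>1 / fact k\<close>; splitting off a first part \<open>m\<close> then leaves
  \<open>fact n / (fact m * fact (n - m))\<close>. This mirrors marking one of \<open>Suc k\<close>
  blocks, of size \<open>m\<close>.\<close>

lemma gen_stirling_Suc:
  "real (Suc k) * gen_stirling \<alpha> n (Suc k) =
   (\<Sum>m=1..n. real (n choose m) * (pochhammer (1 - \<alpha>) (m - 1) * gen_stirling \<alpha> (n - m) k))"
proof -
  have "real (Suc k) * gen_stirling \<alpha> n (Suc k) = fact n / fact k *
      (\<Sum>ns\<in>compositions n (Suc k). \<Prod>j<Suc k. pochhammer (1 - \<alpha>) (ns ! j - 1) / fact (ns ! j))"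
    unfolding gen_stirling_def by (simp add: divide_simps del: prod.lessThan_Suc)
  also have "\<dots> = (\<Sum>m=1..n. fact n / fact k * (pochhammer (1 - \<alpha>) (m - 1) / fact m *
      (\<Sum>ns\<in>compositions (n - m) k. \<Prod>j<k. pochhammer (1 - \<alpha>) (ns ! j - 1) / fact (ns ! j))))"
    by (subst sum_compositions_Suc[of "\<lambda>m. pochhammer (1 - \<alpha>) (m - 1) / fact m"])
      (simp add: sum_distrib_left)
  also have "\<dots> =
      (\<Sum>m=1..n. real (n choose m) * (pochhammer (1 - \<alpha>) (m - 1) * gen_stirling \<alpha> (n - m) k))"
    by (intro sum.cong refl) (simp add: gen_stirling_def binomial_fact)
  finally show ?thesis .
qed

text \<open>Both sides satisfy the recurrence \<open>gen_stirling_Suc\<close>: a partition with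
  \<open>Suc k\<close> blocks admits \<open>Suc k\<close> choices of a marked block, and the weight
  is multiplicative over blocks.\<close>

lemma sum_partitions_card_eq:
  assumes "finite A"
  shows "(\<Sum>P | partition_on A P \<and> card P = k. \<Prod>B\<in>P. pochhammer (1 - \<alpha>) (card B - 1)) =
         gen_stirling \<alpha> (card A) k"
  using assms
proof (induction k arbitrary: A)
  case 0
  \<comment> \<open>Infinite \<open>P\<close> also have \<open>card P = 0\<close>;
    \<open>finite_elements\<close> excludes them, so \<open>P = {}\<close>, which partitions only
    the empty set.\<close>
  have "{P. partition_on A P \<and> card P = 0} = (if A = {} then {{}} else {})"
    using finite_elements[OF 0] by (auto simp: partition_on_def)
  then show ?case
    using 0 by (simp add: gen_stirling_0_0 gen_stirling_n_0 Suc_le_eq card_gt_0_iff)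
next
  case (Suc k)
  define w where "w B = pochhammer (1 - \<alpha>) (card B - 1)" for B :: "'a set"
  have finA: "finite {Q. partition_on (A - B) Q}" for B
    using finitely_many_partition_on[of "A - B"] Suc.prems by simp
  have fin: "finite P" if "partition_on A P" for P
    using finite_elements[OF Suc.prems that] .
  have "real (Suc k) * (\<Sum>P | partition_on A P \<and> card P = Suc k. \<Prod>B\<in>P. w B) =
        (\<Sum>P | partition_on A P. \<Sum>B\<in>P. if card P = Suc k then prod w P else 0)"
    using finitely_many_partition_on[OF Suc.prems]
    by (simp add: sum_distrib_left sum.inter_filter[symmetric] Collect_conj_eq[symmetric]
        if_distrib cong: if_cong conj_cong)
  \<comment> \<open>The summand is rewritten in terms of \<open>B\<close> and
    \<open>P - {B}\<close>, as the double counting requires.\<close>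
  also have "\<dots> = (\<Sum>P | partition_on A P. \<Sum>B\<in>P.
      if card (P - {B}) = k then w B * prod w (P - {B}) else 0)"
  proof (intro sum.cong refl)
    fix P B assume "P \<in> {P. partition_on A P}" "B \<in> P"
    moreover from this have "card P = Suc (card (P - {B}))"
      using card.remove[OF fin] by blast
    ultimately show "(if card P = Suc k then prod w P else 0) =
      (if card (P - {B}) = k then w B * prod w (P - {B}) else 0)"
      using prod.remove[OF fin, of P B w] by auto
  qed
  also have "\<dots> = (\<Sum>B\<in>Pow A - {{}}. \<Sum>Q | partition_on (A - B) Q.
      if card Q = k then w B * prod w Q else 0)"
    by (rule sum_partitions_marked_block[OF Suc.prems])
  also have "\<dots> = (\<Sum>B\<in>Pow A - {{}}.
      pochhammer (1 - \<alpha>) (card B - 1) * gen_stirling \<alpha> (card A - card B) k)"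
  proof (intro sum.cong refl)
    fix B assume B: "B \<in> Pow A - {{}}"
    have "(\<Sum>Q | partition_on (A - B) Q. if card Q = k then w B * prod w Q else 0) =
        w B * (\<Sum>Q | partition_on (A - B) Q \<and> card Q = k. prod w Q)"
      using finA[of B] by (simp add: sum_distrib_left sum.inter_filter[symmetric])
    also have "\<dots> = w B * gen_stirling \<alpha> (card (A - B)) k"
      using Suc.IH[of "A - B"] Suc.prems by (simp add: w_def)
    also have "card (A - B) = card A - card B"
      using B Suc.prems by (intro card_Diff_subset) (auto intro: finite_subset)
    finally show "(\<Sum>Q | partition_on (A - B) Q. if card Q = k then w B * prod w Q else 0) =
        pochhammer (1 - \<alpha>) (card B - 1) * gen_stirling \<alpha> (card A - card B) k"
      by (simp add: w_def)
  qed
  also have "\<dots> = real (Suc k) * gen_stirling \<alpha> (card A) (Suc k)"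
    unfolding gen_stirling_Suc by (rule sum_nonempty_subsets_by_card[OF Suc.prems])
  finally show ?case
    unfolding w_def by (simp del: of_nat_Suc)
qed

lemma card_partition_on_le:
  assumes "finite A" "partition_on A P"
  shows "card P \<le> card A"
proof -
  have "card P = (\<Sum>B\<in>P. 1)"
    by simp
  also have "\<dots> \<le> (\<Sum>B\<in>P. card B)"
  proof (rule sum_mono)
    fix B assume "B \<in> P"
    then have "B \<noteq> {}" "finite B"
      using assms by (auto simp: partition_on_def intro: finite_subset)
    then show "1 \<le> card B"
      by (simp add: Suc_le_eq card_gt_0_iff)
  qed
  also have "\<dots> = card A"
    using product_partition[OF assms(2)] assms
    by (metis Sup_upper finite_subset partition_onD1)
  finally show ?thesis .
qed

text \<open>Grouping by the number of blocks. This is the case of the moment formula in which all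
  \<open>r l\<close> vanish.\<close>

lemma sum_partitions_eq_gen_stirling:
  fixes v :: "nat \<Rightarrow> real"
  assumes "finite A"
  shows "(\<Sum>P | partition_on A P. v (card P) * (\<Prod>B\<in>P. pochhammer (1 - \<alpha>) (card B - 1))) =
         (\<Sum>k\<le>card A. v k * gen_stirling \<alpha> (card A) k)"
proof -
  let ?w = "\<lambda>P. \<Prod>B\<in>P. pochhammer (1 - \<alpha>) (card B - 1)"
  have "(\<Sum>P | partition_on A P. v (card P) * ?w P) =
        (\<Sum>k\<le>card A. \<Sum>P\<in>{P \<in> {P. partition_on A P}. card P = k}. v (card P) * ?w P)"
    using finitely_many_partition_on[OF assms] card_partition_on_le[OF assms]
    by (intro sum.group[symmetric]) auto
  also have "\<dots> = (\<Sum>k\<le>card A. v k * gen_stirling \<alpha> (card A) k)"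
    by (intro sum.cong refl) (simp add: sum_partitions_card_eq[OF assms, symmetric] sum_distrib_left)
  finally show ?thesis .
qed

section \<open>Factorial moments of the block counts\<close>

lemma falling_factorial_0 [simp]: "falling_factorial x 0 = 1"
  by (simp add: falling_factorial_def)

text \<open>The first factor is split off rather than the last, so that the remaining argument
  \<open>x - 1\<close> is the block count after the marked block is removed.\<close>

lemma falling_factorial_Suc: "falling_factorial x (Suc n) = x * falling_factorial (x - 1) n"
  by (simp add: falling_factorial_def prod.lessThan_Suc_shift algebra_simps del: prod.lessThan_Suc)

text \<open>\<open>v\<close> is an arbitrary function of the number of blocks because the induction
  replaces it by \<open>\<lambda>k. v (Suc k)\<close>, while \<open>A\<close> loses a block of size
  \<open>i\<close> and \<open>r i\<close> drops by one.\<close>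

lemma sum_partitions_factorial_moment:
  fixes v :: "nat \<Rightarrow> real" and r :: "nat \<Rightarrow> nat"
  assumes "finite L" "0 \<notin> L" "finite A" "(\<Sum>l\<in>L. l * r l) \<le> card A"
  shows "(\<Sum>P | partition_on A P. v (card P) * (\<Prod>B\<in>P. pochhammer (1 - \<alpha>) (card B - 1)) *
            (\<Prod>l\<in>L. falling_factorial (real (card {B\<in>P. card B = l})) (r l))) =
         fact (card A) / (\<Prod>l\<in>L. fact l ^ r l) *
         ((\<Prod>l\<in>L. pochhammer (1 - \<alpha>) (l - 1) ^ r l) / fact (card A - (\<Sum>l\<in>L. l * r l))) *
         (\<Sum>k\<le>card A - (\<Sum>l\<in>L. l * r l).
            v ((\<Sum>l\<in>L. r l) + k) * gen_stirling \<alpha> (card A - (\<Sum>l\<in>L. l * r l)) k)"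
  using assms(3,4)
proof (induction "\<Sum>l\<in>L. r l" arbitrary: r A v)
  case 0
  then have "r l = 0" if "l \<in> L" for l
    using that assms(1) by simp
  then show ?case
    using sum_partitions_eq_gen_stirling[OF \<open>finite A\<close>, of v \<alpha>] by simp
next
  case (Suc N)
  obtain i where i: "i \<in> L" "r i > 0"
    using Suc.hyps(2) by (metis bot_nat_0.not_eq_extremum nat.distinct(1) sum.neutral)
  define s where "s = r(i := r i - 1)"
  have ri: "r i = Suc (s i)"
    using i by (simp add: s_def)
  define L' where "L' = L - {i}"
  have L: "L = insert i L'" "i \<notin> L'" "finite L'"
    using i assms(1) by (auto simp: L'_def)
  have rs: "r l = s l" if "l \<in> L'" for l
    using that L by (auto simp: s_def)
  have sum_r: "(\<Sum>l\<in>L. r l) = Suc (\<Sum>l\<in>L. s l)"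
    using L ri rs by simp
  have sum_lr: "(\<Sum>l\<in>L. l * r l) = i + (\<Sum>l\<in>L. l * s l)"
    using L ri rs by simp
  have prod_pow: "(\<Prod>l\<in>L. f l ^ r l) = f i * (\<Prod>l\<in>L. f l ^ s l)" for f :: "nat \<Rightarrow> real"
    using L ri rs by simp
  have i_pos: "i > 0"
    using i(1) assms(2) by (cases i) auto
  have i_le: "i \<le> card A"
    using Suc.prems sum_lr by simp
  define w where "w B = pochhammer (1 - \<alpha>) (card B - 1)" for B :: "'a set"
  define c where "c P l = real (card {B\<in>P. card B = l})" for P :: "'a set set" and l
  \<comment> \<open>The summand of the induction hypothesis for partitions \<open>Q\<close> of
    \<open>A - B\<close>: the marked block accounts for the \<open>Suc\<close> in the argument of
    \<open>v\<close>, and \<open>s\<close> replaces \<open>r\<close>.\<close>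
  define G where "G Q = v (Suc (card Q)) * prod w Q * (\<Prod>l\<in>L. falling_factorial (c Q l) (s l))"
    for Q
  define m where "m = card A - i"
  have fin: "finite P" if "partition_on A P" for P
    using finite_elements[OF Suc.prems(1) that] .

  have "(\<Sum>P | partition_on A P. v (card P) * prod w P *
          (\<Prod>l\<in>L. falling_factorial (c P l) (r l))) =
        (\<Sum>P | partition_on A P. \<Sum>B\<in>P. if card B = i then w B * G (P - {B}) else 0)"
  proof (rule sum.cong[OF refl])
    fix P assume "P \<in> {P. partition_on A P}"
    then have P: "finite P"
      using fin by simp
    \<comment> \<open>What is left of the summand once the factor \<open>c P i\<close> is split off;
      that factor then becomes the sum over the blocks of size \<open>i\<close>.\<close>
    let ?H = "v (card P) * prod w P * (falling_factorial (c P i - 1) (s i) *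
      (\<Prod>l\<in>L'. falling_factorial (c P l) (s l)))"
    have "v (card P) * prod w P * (\<Prod>l\<in>L. falling_factorial (c P l) (r l)) = c P i * ?H"
      using L rs by (simp add: ri falling_factorial_Suc)
    also have "\<dots> = (\<Sum>B\<in>P. if card B = i then ?H else 0)"
      using P by (simp add: c_def sum.inter_filter[symmetric])
    also have "\<dots> = (\<Sum>B\<in>P. if card B = i then w B * G (P - {B}) else 0)"
    proof (intro sum.cong refl if_cong)
      fix B assume B: "B \<in> P" "card B = i"
      \<comment> \<open>Removing \<open>B\<close> lowers the count for size \<open>i\<close> by one
        and leaves the counts for the sizes in \<open>L'\<close> unchanged.\<close>
      have "{C \<in> P. card C = i} = insert B {C \<in> P - {B}. card C = i}"
        using B by auto
      then have ci: "c P i = c (P - {B}) i + 1"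
        using P by (simp add: c_def)
      have "{C \<in> P. card C = l} = {C \<in> P - {B}. card C = l}" if "l \<in> L'" for l
        using B that L by auto
      then have "c P l = c (P - {B}) l" if "l \<in> L'" for l
        using that by (simp add: c_def)
      then show "?H = w B * G (P - {B})"
        using L by (simp add: G_def ci card.remove[OF P B(1)] prod.remove[OF P B(1)])
    qed
    finally show "v (card P) * prod w P * (\<Prod>l\<in>L. falling_factorial (c P l) (r l)) =
        (\<Sum>B\<in>P. if card B = i then w B * G (P - {B}) else 0)" .
  qed
  also have "\<dots> = (\<Sum>B\<in>Pow A - {{}}. \<Sum>Q | partition_on (A - B) Q.
      if card B = i then w B * G Q else 0)"
    by (rule sum_partitions_marked_block[OF Suc.prems(1)])
  also have "\<dots> = (\<Sum>B\<in>Pow A - {{}}. if card B = i then pochhammer (1 - \<alpha>) (i - 1) *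
      (fact m / (\<Prod>l\<in>L. fact l ^ s l) *
       ((\<Prod>l\<in>L. pochhammer (1 - \<alpha>) (l - 1) ^ s l) / fact (m - (\<Sum>l\<in>L. l * s l))) *
       (\<Sum>k\<le>m - (\<Sum>l\<in>L. l * s l).
          v (Suc ((\<Sum>l\<in>L. s l) + k)) * gen_stirling \<alpha> (m - (\<Sum>l\<in>L. l * s l)) k)) else 0)"
    (is "_ = (\<Sum>B\<in>_. if card B = i then _ * ?T else 0)")
  proof (intro sum.cong refl)
    fix B assume B: "B \<in> Pow A - {{}}"
    have "(\<Sum>Q | partition_on (A - B) Q. w B * G Q) = pochhammer (1 - \<alpha>) (i - 1) * ?T"
      if "card B = i"
    proof -
      have cardAB: "card (A - B) = m"
        unfolding m_def using B Suc.prems(1) that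
        by (subst card_Diff_subset) (auto intro: finite_subset)
      have "(\<Sum>Q | partition_on (A - B) Q. G Q) = ?T"
        unfolding G_def w_def c_def
        using Suc.hyps(1)[of s "A - B" "\<lambda>k. v (Suc k)"] Suc.hyps(2) Suc.prems sum_r sum_lr cardAB
        by (simp add: m_def)
      then show ?thesis
        using that by (simp add: w_def sum_distrib_left[symmetric])
    qed
    then show "(\<Sum>Q | partition_on (A - B) Q. if card B = i then w B * G Q else 0) =
        (if card B = i then pochhammer (1 - \<alpha>) (i - 1) * ?T else 0)"
      by simp
  qed
  also have "\<dots> = (\<Sum>j=1..card A. real (card A choose j) *
      (if j = i then pochhammer (1 - \<alpha>) (i - 1) * ?T else 0))"
    by (rule sum_nonempty_subsets_by_card[OF Suc.prems(1)])
  \<comment> \<open>Only \<open>j = i\<close> survives, and \<open>i\<close> lies in the range since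
    \<open>0 \<notin> L\<close> and \<open>i \<le> card A\<close>.\<close>
  also have "\<dots> = real (card A choose i) * (pochhammer (1 - \<alpha>) (i - 1) * ?T)"
    using i_pos i_le by (simp add: if_distrib cong: if_cong)
  \<comment> \<open>The binomial coefficient times \<open>fact m\<close> is
    \<open>fact (card A) / fact i\<close>. This \<open>fact i\<close> and
    \<open>pochhammer (1 - \<alpha>) (i - 1)\<close> raise the exponents at \<open>i\<close> from
    \<open>s i\<close> to \<open>r i\<close>.\<close>
  also have "\<dots> = fact (card A) / (\<Prod>l\<in>L. fact l ^ r l) *
         ((\<Prod>l\<in>L. pochhammer (1 - \<alpha>) (l - 1) ^ r l) / fact (card A - (\<Sum>l\<in>L. l * r l))) *
         (\<Sum>k\<le>card A - (\<Sum>l\<in>L. l * r l).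
            v ((\<Sum>l\<in>L. r l) + k) * gen_stirling \<alpha> (card A - (\<Sum>l\<in>L. l * r l)) k)"
    unfolding prod_pow sum_r sum_lr using i_le
    by (simp add: m_def binomial_fact)
  finally show ?case
    unfolding w_def c_def .
qed

section \<open>Expectations as finite sums over the partitions of \<open>{1..n}\<close>\<close>

context random_partition
begin

lemma partition_on_restrict_partition:
  "\<omega> \<in> space M \<Longrightarrow> partition_on {1..n} (restrict_partition n (X \<omega>))"
  using measurable_space[OF measurable_restrict[of n], of \<omega>] by simp

lemma sets_restrict_eq:
  assumes "partition_on {1..n} P"
  shows "{\<omega> \<in> space M. restrict_partition n (X \<omega>) = P} \<in> events"
proof -
  have "(\<lambda>\<omega>. restrict_partition n (X \<omega>)) -` {P} \<inter> space M \<in> events"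
    using assms by (intro measurable_sets[OF measurable_restrict[of n]]) auto
  also have "(\<lambda>\<omega>. restrict_partition n (X \<omega>)) -` {P} \<inter> space M =
      {\<omega> \<in> space M. restrict_partition n (X \<omega>) = P}"
    by auto
  finally show ?thesis .
qed

text \<open>There are finitely many partitions of \<open>{1..n}\<close>, so the integrand is a
  finite linear combination of indicators of events.\<close>

lemma expectation_restrict:
  fixes g :: "nat set set \<Rightarrow> real"
  shows "expectation (\<lambda>\<omega>. g (restrict_partition n (X \<omega>))) =
    (\<Sum>P | partition_on {1..n} P. prob {\<omega> \<in> space M. restrict_partition n (X \<omega>) = P} * g P)"
proof -
  let ?E = "\<lambda>P. {\<omega> \<in> space M. restrict_partition n (X \<omega>) = P}"
  have fin: "finite {P. partition_on {1..n} P}"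
    by (rule finitely_many_partition_on) simp
  have "expectation (\<lambda>\<omega>. g (restrict_partition n (X \<omega>))) =
      expectation (\<lambda>\<omega>. \<Sum>P | partition_on {1..n} P. indicator (?E P) \<omega> * g P)"
  proof (rule Bochner_Integration.integral_cong[OF refl])
    fix \<omega> assume "\<omega> \<in> space M"
    then show "g (restrict_partition n (X \<omega>)) =
        (\<Sum>P | partition_on {1..n} P. indicator (?E P) \<omega> * g P)"
      using fin partition_on_restrict_partition[of \<omega> n] by (simp add: indicator_def if_distrib cong: if_cong)
  qed
  also have "\<dots> = (\<Sum>P | partition_on {1..n} P. expectation (\<lambda>\<omega>. indicator (?E P) \<omega> * g P))"
    by (intro Bochner_Integration.integral_sum integrable_mult_left integrable_real_indicator)
      (auto simp: sets_restrict_eq emeasure_eq_measure)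
  also have "\<dots> = (\<Sum>P | partition_on {1..n} P. prob (?E P) * g P)"
    by (intro sum.cong refl) (simp add: sets_restrict_eq Int_absorb1 sets.sets_into_space)
  finally show ?thesis .
qed

end

text \<open>The Gibbs law reduces this to the deterministic sum with \<open>A = L = {1..n}\<close>
  and \<open>v = V n\<close>. If \<open>R = 0\<close>, then \<open>m = n \<ge> 1\<close>, so the
  unconstrained value \<open>V n 0\<close> is multiplied by
  \<open>gen_stirling \<alpha> n 0 = 0\<close>.\<close>

lemma (in gibbs_partition) factorial_moment:
  fixes r :: "nat \<Rightarrow> nat"
  assumes "n \<ge> 1" "(\<Sum>l=1..n. l * r l) \<le> n"
  defines "m \<equiv> n - (\<Sum>l=1..n. l * r l)" and "R \<equiv> (\<Sum>l=1..n. r l)"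
  shows "expectation (\<lambda>\<omega>. \<Prod>l=1..n. falling_factorial (real (block_count X l n \<omega>)) (r l)) =
      fact n / (\<Prod>l=1..n. fact l ^ r l) *
      ((\<Prod>l=1..n. pochhammer (1 - \<alpha>) (l - 1) ^ r l) / fact m) *
      (\<Sum>k=R..R + m. V n k * gen_stirling \<alpha> m (k - R))"
proof -
  have "expectation (\<lambda>\<omega>. \<Prod>l=1..n. falling_factorial (real (block_count X l n \<omega>)) (r l)) =
      (\<Sum>P | partition_on {1..n} P. V n (card P) *
        (\<Prod>B\<in>P. pochhammer (1 - \<alpha>) (card B - 1)) *
        (\<Prod>l=1..n. falling_factorial (real (card {B\<in>P. card B = l})) (r l)))"
    unfolding block_count_def
    by (subst expectation_restrict) (simp add: prob_restrict[OF assms(1)])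
  also have "\<dots> = fact n / (\<Prod>l=1..n. fact l ^ r l) *
      ((\<Prod>l=1..n. pochhammer (1 - \<alpha>) (l - 1) ^ r l) / fact m) *
      (\<Sum>k\<le>m. V n (R + k) * gen_stirling \<alpha> m k)"
    unfolding m_def R_def
    using sum_partitions_factorial_moment[of "{1..n}" "{1..n}" r "V n" \<alpha>] assms(2) by simp
  \<comment> \<open>The natural-number subtraction \<open>k - R\<close> is exact on the new
    range.\<close>
  also have "(\<Sum>k\<le>m. V n (R + k) * gen_stirling \<alpha> m k) =
      (\<Sum>k=R..R + m. V n k * gen_stirling \<alpha> m (k - R))"
    by (rule sum.reindex_bij_witness[where i = "\<lambda>k. k - R" and j = "\<lambda>k. R + k"]) auto
  finally show ?thesis .
qed

theorem proposition2:
  fixes M :: "'w measure" and X :: "'w \<Rightarrow> nat set set"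
    and \<alpha> :: real and V :: "nat \<Rightarrow> nat \<Rightarrow> real" and n :: nat
  assumes "gibbs_partition M X \<alpha> V"
    and "n \<ge> 1"
  shows "(\<forall>r :: nat \<Rightarrow> nat. (\<Sum>l=1..n. l * r l) \<le> n \<longrightarrow>
      prob_space.expectation M
        (\<lambda>\<omega>. \<Prod>l=1..n. falling_factorial (real (block_count X l n \<omega>)) (r l)) =
      fact n / (\<Prod>l=1..n. fact l ^ r l) *
      ((\<Prod>l=1..n. pochhammer (1 - \<alpha>) (l - 1) ^ r l) / fact (n - (\<Sum>l=1..n. l * r l))) *
      (\<Sum>k = (\<Sum>l=1..n. r l)..(\<Sum>l=1..n. r l) + (n - (\<Sum>l=1..n. l * r l)).
        V n k * gen_stirling \<alpha> (n - (\<Sum>l=1..n. l * r l)) (k - (\<Sum>l=1..n. r l))))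
    \<and> (\<forall>l\<in>{1..n}. \<forall>r :: nat. r \<le> n div l \<longrightarrow>
      prob_space.expectation M (\<lambda>\<omega>. falling_factorial (real (block_count X l n \<omega>)) r) =
      fact n * pochhammer (1 - \<alpha>) (l - 1) ^ r / (fact l ^ r * fact (n - l * r)) *
      (\<Sum>k = r..r + (n - r * l). V n k * gen_stirling \<alpha> (n - r * l) (k - r)))"
proof (intro conjI allI ballI impI)
  interpret gibbs_partition M X \<alpha> V
    by fact
  show "expectation (\<lambda>\<omega>. \<Prod>l=1..n. falling_factorial (real (block_count X l n \<omega>)) (r l)) =
      fact n / (\<Prod>l=1..n. fact l ^ r l) *
      ((\<Prod>l=1..n. pochhammer (1 - \<alpha>) (l - 1) ^ r l) / fact (n - (\<Sum>l=1..n. l * r l))) *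
      (\<Sum>k = (\<Sum>l=1..n. r l)..(\<Sum>l=1..n. r l) + (n - (\<Sum>l=1..n. l * r l)).
        V n k * gen_stirling \<alpha> (n - (\<Sum>l=1..n. l * r l)) (k - (\<Sum>l=1..n. r l)))"
    if "(\<Sum>l=1..n. l * r l) \<le> n" for r :: "nat \<Rightarrow> nat"
    using factorial_moment[OF \<open>n \<ge> 1\<close> that] .
  fix l r :: nat
  assume l: "l \<in> {1..n}" and r: "r \<le> n div l"
  \<comment> \<open>The single-size formula is the joint one for the exponents concentrated at
    \<open>l\<close>; all factors with \<open>j \<noteq> l\<close> become 1.\<close>
  define s where "s j = (if j = l then r else 0)" for j
  have sum_s: "(\<Sum>j=1..n. s j) = r" and sum_js: "(\<Sum>j=1..n. j * s j) = l * r"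
    using l by (simp_all add: s_def if_distrib cong: if_cong)
  have pow_s: "(\<Prod>j=1..n. f j ^ s j) = f l ^ r" for f :: "nat \<Rightarrow> real"
  proof -
    have "(\<Prod>j=1..n. f j ^ s j) = (\<Prod>j=1..n. if j = l then f j ^ r else 1)"
      by (intro prod.cong) (auto simp: s_def)
    then show ?thesis
      using l by simp
  qed
  have ff_s: "(\<Prod>j=1..n. falling_factorial (c j) (s j)) = falling_factorial (c l) r"
    for c :: "nat \<Rightarrow> real"
  proof -
    have "(\<Prod>j=1..n. falling_factorial (c j) (s j)) =
        (\<Prod>j=1..n. if j = l then falling_factorial (c j) r else 1)"
      by (intro prod.cong) (auto simp: s_def)
    then show ?thesis
      using l by simp
  qed
  \<comment> \<open>As \<open>l > 0\<close>, the bound \<open>r \<le> n div l\<close> says exactly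
    that \<open>l * r \<le> n\<close>.\<close>
  have "(\<Sum>j=1..n. j * s j) \<le> n"
    unfolding sum_js using r l by (simp add: less_eq_div_iff_mult_less_eq mult.commute)
  from factorial_moment[OF \<open>n \<ge> 1\<close> this]
  show "expectation (\<lambda>\<omega>. falling_factorial (real (block_count X l n \<omega>)) r) =
      fact n * pochhammer (1 - \<alpha>) (l - 1) ^ r / (fact l ^ r * fact (n - l * r)) *
      (\<Sum>k = r..r + (n - r * l). V n k * gen_stirling \<alpha> (n - r * l) (k - r))"
    unfolding sum_s sum_js pow_s ff_s by (simp add: mult.commute)
qed

end
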